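(* Let $\alpha\in\mathbb C$ and let $L$ be a $4$-dimensional solvable right Leibniz algebra over $\mathbb C$ whose nilradical is isomorphic to the $3$-dimensional Leibniz algebra $\mu_3(\alpha)$ with basis $\{x,y,z\}$ and non-zero brackets of basis elements $[x,x]=z$, $[y,y]=\alpha z$, $[x,y]=z$. Then $L$ is dextral symmetric if and only if it is isomorphic to the algebra $\mathscr R_2$ with basis $\{x,y,z,w\}$ and non-zero brackets of basis elements $$[z,y]=w,\qquad [z,x]=z,\qquad [w,x]=w.$$
   Context: A right Leibniz algebra over a field $F$ is an $F$-vector space $L$ with a bilinear bracket $[\,,]:L\times L\to L$ satisfying $[a,[b,c]]=[[a,b],c]-[[a,c],b]$ for all $a,b,c\in L$. $L$ is solvable if $L^{[k]}=0$ for some $k\in\mathbb N$, where $L^{[1]}=L$, $L^{[n+1]}=[L^{[n]},L^{[n]}]$ (span of brackets). A Leibniz algebra $N$ is nilpotent (equivalently, right nilpotent) if $N^{<k>}=0$ for some $k$, where $N^{<1>}=N$, $N^{<n+1>}=[N^{<n>},N]$. The nilradical of $L$ is its maximal nilpotent (two-sided) ideal. $L$ is dextral symmetric if for all $a,b,c\in L$, $[a,[b,c]]=0$ implies $[b,[a,c]]=0$. Brackets of basis elements not listed are zero. *)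

theory Defs
  imports "HOL-Analysis.Analysis"
begin

locale right_leibniz_algebra = vector_space scale
  for scale :: "'f::field \<Rightarrow> 'a::ab_group_add \<Rightarrow> 'a" +
  fixes bracket :: "'a \<Rightarrow> 'a \<Rightarrow> 'a"
  assumes bracket_add_left: "bracket (a + b) c = bracket a c + bracket b c"
    and bracket_add_right: "bracket a (b + c) = bracket a b + bracket a c"
    and bracket_scale_left: "bracket (scale r a) b = scale r (bracket a b)"
    and bracket_scale_right: "bracket a (scale r b) = scale r (bracket a b)"
    and right_leibniz: "bracket a (bracket b c) = bracket (bracket a b) c - bracket (bracket a c) b"
begin

definition bracket_span :: "'a set \<Rightarrow> 'a set \<Rightarrow> 'a set" where
  "bracket_span A B = span {bracket a b | a b. a \<in> A \<and> b \<in> B}"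

(* Both series are indexed from 0, so that S^{[n+1]} is derived_series S n
   and S^{<n+1>} is lower_central_series S n. *)

primrec derived_series :: "'a set \<Rightarrow> nat \<Rightarrow> 'a set" where
  "derived_series S 0 = S"
| "derived_series S (Suc n) = bracket_span (derived_series S n) (derived_series S n)"

primrec lower_central_series :: "'a set \<Rightarrow> nat \<Rightarrow> 'a set" where
  "lower_central_series S 0 = S"
| "lower_central_series S (Suc n) = bracket_span (lower_central_series S n) S"

definition solvable :: "'a set \<Rightarrow> bool" where
  "solvable S \<longleftrightarrow> (\<exists>n. derived_series S n = {0})"

definition nilpotent :: "'a set \<Rightarrow> bool" where
  "nilpotent S \<longleftrightarrow> (\<exists>n. lower_central_series S n = {0})"

definition two_sided_ideal :: "'a set \<Rightarrow> bool" where
  "two_sided_ideal I \<longleftrightarrow>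
     subspace I \<and> (\<forall>a\<in>I. \<forall>b. bracket a b \<in> I \<and> bracket b a \<in> I)"

(* Maximality is with respect to inclusion. In finite dimension a sum of two nilpotent
   ideals is nilpotent, so there is exactly one such N, and it contains every nilpotent ideal. *)
definition nilradical :: "'a set \<Rightarrow> bool" where
  "nilradical N \<longleftrightarrow> two_sided_ideal N \<and> nilpotent N \<and>
     (\<forall>I. two_sided_ideal I \<and> nilpotent I \<and> N \<subseteq> I \<longrightarrow> I = N)"

definition dextral_symmetric :: bool where
  "dextral_symmetric \<longleftrightarrow>
     (\<forall>a b c. bracket a (bracket b c) = 0 \<longrightarrow> bracket b (bracket a c) = 0)"

end

(* A and B are meant to be subalgebras (possibly UNIV) of the ambient algebras. *)
definition algebra_isomorphic ::
  "('f \<Rightarrow> 'a::plus \<Rightarrow> 'a) \<Rightarrow> ('a \<Rightarrow> 'a \<Rightarrow> 'a) \<Rightarrow> 'a set \<Rightarrow>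
   ('f \<Rightarrow> 'b::plus \<Rightarrow> 'b) \<Rightarrow> ('b \<Rightarrow> 'b \<Rightarrow> 'b) \<Rightarrow> 'b set \<Rightarrow> bool" where
  "algebra_isomorphic s1 br1 A s2 br2 B \<longleftrightarrow>
     (\<exists>f. bij_betw f A B \<and>
          (\<forall>a\<in>A. \<forall>b\<in>A. f (a + b) = f a + f b) \<and>
          (\<forall>r. \<forall>a\<in>A. f (s1 r a) = s2 r (f a)) \<and>
          (\<forall>a\<in>A. \<forall>b\<in>A. f (br1 a b) = br2 (f a) (f b)))"

(* The bilinear bracket on F^n whose value on the standard basis vectors e_i, e_j is c i j. *)
definition table_bracket ::
  "('n::finite \<Rightarrow> 'n \<Rightarrow> 'f::field ^ 'n) \<Rightarrow> 'f ^ 'n \<Rightarrow> 'f ^ 'n \<Rightarrow> 'f ^ 'n" where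
  "table_bracket c u v = (\<Sum>i\<in>UNIV. \<Sum>j\<in>UNIV. (u $ i * v $ j) *s c i j)"

(* Basis: x, y, z = e_1, e_2, e_3. *)
definition mu3_bracket :: "complex \<Rightarrow> complex ^ 3 \<Rightarrow> complex ^ 3 \<Rightarrow> complex ^ 3" where
  "mu3_bracket \<alpha> = table_bracket (\<lambda>i j.
     if i = 1 \<and> j = 1 then axis 3 1
     else if i = 2 \<and> j = 2 then \<alpha> *s axis 3 1
     else if i = 1 \<and> j = 2 then axis 3 1
     else 0)"

(* Basis: x, y, z, w = e_1, e_2, e_3, e_4. *)
definition R2_bracket :: "complex ^ 4 \<Rightarrow> complex ^ 4 \<Rightarrow> complex ^ 4" where
  "R2_bracket = table_bracket (\<lambda>i j.
     if i = 3 \<and> j = 2 then axis 4 1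
     else if i = 3 \<and> j = 1 then axis 3 1
     else if i = 4 \<and> j = 1 then axis 4 1
     else 0)"

lemma mu3_bracket_components:
  "mu3_bracket \<alpha> u v $ 1 = 0"
  "mu3_bracket \<alpha> u v $ 2 = 0"
  "mu3_bracket \<alpha> u v $ 3 = u $ 1 * v $ 1 + \<alpha> * (u $ 2 * v $ 2) + u $ 1 * v $ 2"
  by (simp_all add: mu3_bracket_def table_bracket_def sum_3 axis_def algebra_simps)

lemma R2_bracket_components:
  "R2_bracket u v $ 1 = 0"
  "R2_bracket u v $ 2 = 0"
  "R2_bracket u v $ 3 = u $ 3 * v $ 1"
  "R2_bracket u v $ 4 = u $ 3 * v $ 2 + u $ 4 * v $ 1"
  by (simp_all add: R2_bracket_def table_bracket_def sum_4 axis_def algebra_simps)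

lemma right_leibniz_algebra_mu3: "right_leibniz_algebra (*s) (mu3_bracket \<alpha>)"
  by unfold_locales
    (simp_all add: vec_eq_iff forall_3 mu3_bracket_components algebra_simps)

lemma right_leibniz_algebra_R2: "right_leibniz_algebra (*s) R2_bracket"
  by unfold_locales
    (simp_all add: vec_eq_iff forall_4 R2_bracket_components algebra_simps)

end

(* Let L = N + Ct with N = mu_3(alpha) spanned by x, y, z. In any right Leibniz algebra
   [a, [b, c]] = - [a, [c, b]], so [t, z] = [t, [x, x]] = 0, i.e. [t, [N, N]] = 0, and dextral symmetry gives
   [N, [t, N]] = 0 = [N, [N, t]].
   If alpha is nonzero, the form on N/Cz given by the bracket is nondegenerate, so [N, t] lies
   in Cz, which makes L nilpotent: a contradiction. If alpha = 0, replacing x by x - y leaves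
   [x, y] = z as the only product in N; then [x, t] = a x + m z with a nonzero (again because L
   is not nilpotent), and rescaling and shifting t and y by elements of N yields the table of
   R_2. Conversely [a, [b, c]] = 0 holds identically in R_2. *)

theory Submission
  imports Defs
begin

section \<open>Isomorphisms and explicit bases\<close>

lemma algebra_isomorphic_UNIV_symI:
  fixes g :: "'b::plus \<Rightarrow> 'a::plus"
  assumes bij: "bij g"
    and add: "\<And>u v. g (u + v) = g u + g v"
    and scale: "\<And>r u. g (s2 r u) = s1 r (g u)"
    and bracket: "\<And>u v. g (br2 u v) = br1 (g u) (g v)"
  shows "algebra_isomorphic s1 br1 UNIV s2 br2 UNIV"
proof -
  have g_inv: "g (inv g a) = a" for a
    using bij by (simp add: bij_is_surj surj_f_inv_f)
  have inv_g: "inv g (g u) = u" for u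
    using bij by (simp add: bij_is_inj)
  have "inv g (a + b) = inv g a + inv g b" "inv g (s1 r a) = s2 r (inv g a)"
    "inv g (br1 a b) = br2 (inv g a) (inv g b)" for a b r
    by (metis add g_inv inv_g, metis scale g_inv inv_g, metis bracket g_inv inv_g)
  then show ?thesis
    unfolding algebra_isomorphic_def using bij_imp_bij_inv[OF bij] by blast
qed

text \<open>Pulling the standard basis of \<open>complex ^ 3\<close> back along the isomorphism
  gives a basis and a multiplication table inside \<open>N\<close>, so that all later computations
  take place in the ambient algebra.\<close>

lemma mu3_isomorphic_basis:
  fixes scale :: "complex \<Rightarrow> 'a::ab_group_add \<Rightarrow> 'a"
  assumes "right_leibniz_algebra scale bracket"
    and ideal: "right_leibniz_algebra.two_sided_ideal scale bracket N"
    and "algebra_isomorphic scale bracket N (*s) (mu3_bracket \<alpha>) UNIV"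
  obtains x y z where
    "\<And>n. n \<in> N \<longleftrightarrow> (\<exists>a b c. n = scale a x + scale b y + scale c z)"
    "\<And>a b c. scale a x + scale b y + scale c z = 0 \<Longrightarrow> a = 0 \<and> b = 0 \<and> c = 0"
    "bracket x x = z" "bracket x y = z" "bracket x z = 0"
    "bracket y x = 0" "bracket y y = scale \<alpha> z" "bracket y z = 0"
    "bracket z x = 0" "bracket z y = 0" "bracket z z = 0"
proof -
  interpret right_leibniz_algebra scale bracket by fact
  have sub: "subspace N" and closed: "\<And>a b. a \<in> N \<Longrightarrow> bracket a b \<in> N"
    using ideal by (auto simp: two_sided_ideal_def)
  obtain f where bij: "bij_betw f N UNIV"
    and f_add: "\<And>a b. a \<in> N \<Longrightarrow> b \<in> N \<Longrightarrow> f (a + b) = f a + f b"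
    and f_scale: "\<And>r a. a \<in> N \<Longrightarrow> f (scale r a) = r *s f a"
    and f_bracket: "\<And>a b. a \<in> N \<Longrightarrow> b \<in> N \<Longrightarrow> f (bracket a b) = mu3_bracket \<alpha> (f a) (f b)"
    using assms(3) unfolding algebra_isomorphic_def by auto
  have inj: "a = b" if "a \<in> N" "b \<in> N" "f a = f b" for a b
    using bij that by (meson bij_betw_def inj_onD)
  have surj: "\<exists>a\<in>N. f a = v" for v
    using bij by (metis UNIV_I bij_betw_def imageE)
  obtain x y z where N: "x \<in> N" "y \<in> N" "z \<in> N"
    and f: "f x = axis 1 1" "f y = axis 2 1" "f z = axis 3 1"
    using surj by metis
  note closed' = subspace_add[OF sub] subspace_scale[OF sub] subspace_0[OF sub] closed
  have f_0: "f 0 = 0"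
    using f_scale[of 0 0] closed' by simp
  have comb: "f (scale a x + scale b y + scale c z) = vector [a, b, c]" for a b c
    using N closed' by (simp add: f_add f_scale f vec_eq_iff forall_3 axis_def)
  \<comment> \<open>As a rewrite rule this turns every entry of the table into an equation between
    coordinates in \<open>complex ^ 3\<close>.\<close>
  have f_iff: "u = v \<longleftrightarrow> f u = f v" if "u \<in> N" "v \<in> N" for u v
    using inj that by blast
  show thesis
  proof (rule that[of x y z])
    fix n
    have n: "n = scale (f n $ 1) x + scale (f n $ 2) y + scale (f n $ 3) z" if "n \<in> N"
      by (rule inj) (use that N closed' in \<open>simp_all add: comb vec_eq_iff forall_3\<close>)
    show "n \<in> N \<longleftrightarrow> (\<exists>a b c. n = scale a x + scale b y + scale c z)"
    proof
      assume "n \<in> N"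
      then show "\<exists>a b c. n = scale a x + scale b y + scale c z"
        using n by blast
    next
      assume "\<exists>a b c. n = scale a x + scale b y + scale c z"
      then show "n \<in> N"
        using N closed' by auto
    qed
  next
    fix a b c assume "scale a x + scale b y + scale c z = 0"
    then have "vector [a, b, c] = (0 :: complex ^ 3)"
      using comb f_0 by metis
    then show "a = 0 \<and> b = 0 \<and> c = 0"
      by (simp add: vec_eq_iff forall_3)
  qed (use N closed' in \<open>simp_all add: f_iff f_bracket f_scale f f_0 vec_eq_iff forall_3
         mu3_bracket_components axis_def\<close>)
qed

section \<open>Identities, ideals and nilpotency in a right Leibniz algebra\<close>

context right_leibniz_algebra
begin

lemma subspace_scale_cancel:
  assumes "subspace S" "r \<noteq> 0" "scale r v \<in> S"
  shows "v \<in> S"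
  using subspace_scale[OF assms(1,3), of "inverse r"] assms(2) by simp

lemma bracket_0_left [simp]: "bracket 0 a = 0"
  using bracket_add_left[of 0 0 a] by simp

lemma bracket_0_right [simp]: "bracket a 0 = 0"
  using bracket_add_right[of a 0 0] by simp

lemma bracket_diff_left: "bracket (a - b) c = bracket a c - bracket b c"
  using bracket_add_left[of "a - b" b c] by simp

lemma bracket_diff_right: "bracket a (b - c) = bracket a b - bracket a c"
  using bracket_add_right[of a "b - c" c] by simp

lemmas bracket_linear = bracket_add_left bracket_add_right bracket_diff_left bracket_diff_right
  bracket_scale_left bracket_scale_right

text \<open>The two terms on the right of the Leibniz identity coincide and cancel; for distinct
  arguments, swapping them exchanges the two terms, which gives the antisymmetric version
  below.\<close>

lemma bracket_square_right: "bracket a (bracket b b) = 0"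
  by (simp add: right_leibniz)

lemma bracket_symmetric_right: "bracket a (bracket b c) = - bracket a (bracket c b)"
  by (simp add: right_leibniz)

text \<open>The Leibniz identity says that right multiplication by \<open>c\<close> is a derivation.
  In this form it computes the action of \<open>t\<close> on products of elements of
  \<open>N\<close>.\<close>

lemma bracket_derivation: "bracket (bracket a b) c = bracket (bracket a c) b + bracket a (bracket b c)"
  by (simp add: right_leibniz)

lemma bracket_span_subset:
  assumes "subspace S" "\<And>a b. a \<in> A \<Longrightarrow> b \<in> B \<Longrightarrow> bracket a b \<in> S"
  shows "bracket_span A B \<subseteq> S"
  unfolding bracket_span_def by (rule span_minimal) (use assms in auto)

lemma mem_span_triple:
  "n \<in> span {x, y, z} \<longleftrightarrow> (\<exists>a b c. n = scale a x + scale b y + scale c z)"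
  by (simp add: span_breakdown_eq span_singleton image_iff diff_eq_eq ac_simps)

text \<open>The chain \<open>UNIV\<close>, \<open>N\<close>, \<open>span {z}\<close>,
  \<open>{0}\<close> bounds the lower central series from above, term by term from index 0 to index
  3. Both values of the case distinction on \<alpha> use this to contradict the maximality of
  \<open>N\<close>.\<close>

lemma nilpotent_UNIV_I:
  assumes "subspace N" "\<And>a b. bracket a b \<in> N"
    and "\<And>n b. n \<in> N \<Longrightarrow> bracket n b \<in> span {z}"
    and "\<And>b. bracket z b = 0"
  shows "nilpotent UNIV"
proof -
  have 1: "lower_central_series UNIV 1 \<subseteq> N"
    using assms by (simp add: bracket_span_subset)
  have 2: "lower_central_series UNIV 2 \<subseteq> span {z}"
    using 1 assms(3) unfolding numeral_2_eq_2 One_nat_def lower_central_series.simps(2)[of _ "Suc 0"]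
    by (intro bracket_span_subset) auto
  have "bracket a b = 0" if "a \<in> span {z}" for a b
    using that assms(4) by (auto simp: span_singleton bracket_scale_left)
  then have "lower_central_series UNIV 3 \<subseteq> {0}"
    using 2 unfolding numeral_3_eq_3 numeral_2_eq_2 lower_central_series.simps(2)[of _ "Suc (Suc 0)"]
    by (intro bracket_span_subset) auto
  moreover have "0 \<in> lower_central_series UNIV 3"
    by (simp add: numeral_3_eq_3 bracket_span_def span_zero)
  ultimately show ?thesis
    unfolding nilpotent_def by blast
qed

text \<open>\<open>N\<close> is spanned by three independent vectors, hence has codimension one, and
  any vector outside it spans a complement.\<close>

lemma hyperplane_complement:
  assumes dim: "dim (UNIV :: 'a set) = 4"
    and N: "\<And>n. n \<in> N \<longleftrightarrow> (\<exists>a b c. n = scale a x + scale b y + scale c z)"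
    and indep: "\<And>a b c. scale a x + scale b y + scale c z = 0 \<Longrightarrow> a = 0 \<and> b = 0 \<and> c = 0"
  shows "N \<noteq> UNIV" and "t \<notin> N \<Longrightarrow> \<exists>r. \<exists>n\<in>N. v = scale r t + n"
proof -
  obtain B where B: "independent B" "UNIV \<subseteq> span B" "card B = 4"
    using basis_exists[of UNIV] dim by metis
  \<comment> \<open>An infinite set has \<open>card\<close> 0, so cardinality 4 forces finiteness
    and gives access to the finite-dimensional theory.\<close>
  have "finite B"
    using B(3) card.infinite by force
  interpret finite_dimensional_vector_space scale B
    by unfold_locales (use \<open>finite B\<close> B in auto)
  have N_span: "N = span {x, y, z}"
    using N by (auto simp: mem_span_triple)
  have "dim N \<le> card {x, y, z}"
    unfolding N_span dim_span by (rule dim_le_card') simp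
  then have dim_le: "dim N \<le> 3"
    using card_insert_le_m1[of 3 "{y, z}" x] card_insert_le_m1[of 2 "{z}" y] by simp
  then show "N \<noteq> UNIV"
    using dim by auto
  have ind: "independent {x, y, z}" and card: "card {x, y, z} = 3"
  proof -
    have z: "z \<noteq> 0"
      using indep[of 0 0 1] by auto
    have y: "y \<notin> span {z}"
    proof
      assume "y \<in> span {z}"
      then obtain c where "y = scale c z" by (auto simp: span_singleton)
      then show False using indep[of 0 1 "- c"] by auto
    qed
    have x: "x \<notin> span {y, z}"
    proof
      assume "x \<in> span {y, z}"
      then obtain b c where "x - scale b y = scale c z"
        by (auto simp: span_breakdown_eq span_singleton)
      then show False using indep[of 1 "- b" "- c"] by (auto simp: algebra_simps)
    qed
    have "x \<noteq> y" "x \<noteq> z" "y \<noteq> z"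
      using x y span_base by blast+
    then show "independent {x, y, z}" "card {x, y, z} = 3"
      using x y z by (simp_all add: independent_insert)
  qed
  assume t: "t \<notin> N"
  have "dim N = 3"
    unfolding N_span using dim_span_eq_card_independent[OF ind] card by simp
  then have "dim (insert t N) = 4"
    using t by (simp add: dim_insert N_span span_span)
  then have "span (insert t N) = UNIV"
    using dim_eq_full dim by (simp add: dimension_def)
  then obtain r where "v - scale r t \<in> N"
    using span_breakdown_eq[of v t N] by (auto simp: N_span span_span)
  then show "\<exists>r. \<exists>n\<in>N. v = scale r t + n"
    by (metis add.commute diff_add_cancel)
qed

text \<open>Right multiplication by a square vanishes, so the coefficient of \<open>t\<close> in \<open>[t, t]\<close>
  squares to zero.\<close>

lemma bracket_in_hyperplane_ideal:
  assumes ideal: "two_sided_ideal N" and t: "t \<notin> N"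
    and complement: "\<And>v. \<exists>r. \<exists>n\<in>N. v = scale r t + n"
  shows "bracket a b \<in> N"
proof -
  have sub: "subspace N" and closed: "\<And>n b. n \<in> N \<Longrightarrow> bracket n b \<in> N"
    "\<And>n b. n \<in> N \<Longrightarrow> bracket b n \<in> N"
    using ideal by (auto simp: two_sided_ideal_def)
  note closed' = subspace_add[OF sub] subspace_scale[OF sub] subspace_diff[OF sub] closed
  obtain r n where n: "n \<in> N" "bracket t t = scale r t + n"
    using complement by blast
  have "scale (r * r) t = bracket t (bracket t t) - (scale r n + bracket t n)"
  proof -
    have "bracket t (bracket t t) = bracket t (scale r t + n)"
      by (simp only: n(2))
    also have "\<dots> = scale r (scale r t + n) + bracket t n"
      by (simp add: n(2) bracket_linear)
    finally show ?thesis
      by (simp add: scale_right_distrib)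
  qed
  also have "\<dots> \<in> N"
    unfolding bracket_square_right diff_0
    by (intro subspace_neg[OF sub] subspace_add[OF sub] subspace_scale[OF sub] closed n)
  finally have "scale (r * r) t \<in> N" .
  then have "r = 0"
    using t subspace_scale_cancel[OF sub] by fastforce
  then have tt: "bracket t t \<in> N"
    using n by simp
  obtain r m s k where "a = scale r t + m" "m \<in> N" "b = scale s t + k" "k \<in> N"
    using complement by meson
  then show ?thesis
    using closed' tt by (simp add: bracket_linear)
qed

text \<open>Dextral symmetry moves \<open>u\<close> to the front of [t, [u, v]] = 0, and
  antisymmetry in the inner bracket gives the second equation.\<close>

lemma dextral_symmetric_bracket_ideal:
  assumes "dextral_symmetric" and "\<And>u v. u \<in> N \<Longrightarrow> v \<in> N \<Longrightarrow> bracket t (bracket u v) = 0"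
    and "u \<in> N" "v \<in> N"
  shows "bracket u (bracket t v) = 0" "bracket u (bracket v t) = 0"
proof -
  show "bracket u (bracket t v) = 0"
    using assms unfolding dextral_symmetric_def by blast
  then show "bracket u (bracket v t) = 0"
    using bracket_symmetric_right[of u v t] by simp
qed

text \<open>The whole algebra is an ideal containing \<open>N\<close>; if it were nilpotent,
  maximality would force \<open>N\<close> to equal it.\<close>

lemma not_nilpotent_UNIV_I:
  assumes "nilradical N" "N \<noteq> UNIV"
  shows "\<not> nilpotent UNIV"
proof -
  have "two_sided_ideal UNIV"
    by (simp add: two_sided_ideal_def)
  then show ?thesis
    using assms by (auto simp: nilradical_def)
qed

text \<open>Left multiplications by \<open>x\<close> and \<open>y\<close> together detect everything
  in \<open>N\<close> modulo \<open>z\<close>, and both annihilate [N, t]. So [N, t] lies in the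
  line of \<open>z\<close>, and the chain of \<open>nilpotent_UNIV_I\<close> applies.\<close>

lemma mu3_nondegenerate_nilpotent:
  assumes N: "\<And>n. n \<in> N \<longleftrightarrow> (\<exists>a b c. n = scale a x + scale b y + scale c z)"
    and indep: "\<And>a b c. scale a x + scale b y + scale c z = 0 \<Longrightarrow> a = 0 \<and> b = 0 \<and> c = 0"
    and table: "bracket x x = z" "bracket x y = z" "bracket x z = 0"
      "bracket y x = 0" "bracket y y = scale \<alpha> z" "bracket y z = 0"
      "bracket z x = 0" "bracket z y = 0" "bracket z z = 0"
    and "\<alpha> \<noteq> 0"
    and sub: "\<And>a b. bracket a b \<in> N"
    and complement: "\<And>v. \<exists>r. \<exists>n\<in>N. v = scale r t + n"
    and dextral: "dextral_symmetric"
  shows "nilpotent UNIV"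
proof -
  have subN: "subspace N"
  proof -
    have "N = span {x, y, z}"
      using N by (auto simp: mem_span_triple)
    then show ?thesis by simp
  qed
  have N_xyz: "x \<in> N" "y \<in> N"
    using N[of x] N[of y]
    by (metis add.right_neutral add_0 scale_one scale_zero_left)+
  have z_0: "scale a z = 0 \<Longrightarrow> a = 0" for a
    using indep[of 0 0 a] by simp
  have N_N: "bracket u v \<in> span {z}" if "u \<in> N" "v \<in> N" for u v
    using that table
    by (auto simp: N bracket_linear span_singleton simp flip: scale_left_distrib)
  have t_N: "bracket u (bracket v t) = 0" if "u \<in> N" "v \<in> N" for u v
  proof -
    have "bracket t z = 0"
      using bracket_square_right[of t x] table by simp
    then have "bracket t (bracket u v) = 0" if "u \<in> N" "v \<in> N" for u v
      using N_N[OF that] by (auto simp: span_singleton bracket_linear)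
    then show ?thesis
      using dextral_symmetric_bracket_ideal(2)[OF dextral, of N t] that by blast
  qed
  have N_t: "bracket n t \<in> span {z}" if "n \<in> N" for n
  proof -
    obtain a b c where abc: "bracket n t = scale a x + scale b y + scale c z"
      using sub N by blast
    \<comment> \<open>Left multiplication by \<open>y\<close> sends \<open>bracket n t\<close> to b
      \<alpha> z, and left multiplication by \<open>x\<close> sends it to (a + b) z; both vanish by
      \<open>t_N\<close>.\<close>
    have "scale (b * \<alpha>) z = 0"
      using t_N[OF N_xyz(2) that] by (simp add: abc bracket_linear table)
    then have "b = 0"
      using z_0 \<open>\<alpha> \<noteq> 0\<close> by fastforce
    moreover from this have "scale a z = 0"
      using t_N[OF N_xyz(1) that] by (simp add: abc bracket_linear table)
    ultimately show ?thesis
      using z_0 abc by (auto simp: span_singleton)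
  qed
  have "bracket n v \<in> span {z}" if n: "n \<in> N" for n v
  proof -
    obtain r m where "v = scale r t + m" "m \<in> N"
      using complement by blast
    then show ?thesis
      using N_t[OF n] N_N[OF n] by (simp add: bracket_linear span_add span_scale)
  qed
  moreover have "bracket z v = 0" for v
  proof -
    obtain r m where m: "v = scale r t + m" "m \<in> N"
      using complement by blast
    \<comment> \<open>Since z = [x, x], the derivation rule gives [z, t] = [[x, t], x] + [x,
      [x, t]], and the last term is zero by \<open>t_N\<close>.\<close>
    have "bracket z t = bracket (bracket x t) x"
      using bracket_derivation[of x x t] t_N[OF N_xyz(1) N_xyz(1)] table by simp
    also have "\<dots> = 0"
      using N_t[OF N_xyz(1)] table by (auto simp: span_singleton bracket_linear)
    finally show ?thesis
      using m table by (auto simp: N bracket_linear)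
  qed
  ultimately show ?thesis
    using subN sub by (intro nilpotent_UNIV_I)
qed

end

section \<open>Recognising the algebra R_2\<close>

lemma algebra_isomorphic_R2_dextral_symmetric:
  fixes scale :: "complex \<Rightarrow> 'a::ab_group_add \<Rightarrow> 'a"
  assumes "right_leibniz_algebra scale bracket"
    and "algebra_isomorphic scale bracket UNIV (*s) R2_bracket UNIV"
  shows "right_leibniz_algebra.dextral_symmetric bracket"
proof -
  interpret right_leibniz_algebra scale bracket by fact
  obtain f where bij: "bij f" and f_scale: "\<And>r a. f (scale r a) = r *s f a"
    and f_bracket: "\<And>a b. f (bracket a b) = R2_bracket (f a) (f b)"
    using assms(2) unfolding algebra_isomorphic_def by auto
  \<comment> \<open>\<open>R2_bracket\<close> reads only coordinates 1 and 2 of its right argument,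
    and both are zero for any bracket.\<close>
  have "f (bracket a (bracket b c)) = f 0" for a b c
    using f_scale[of 0 0]
    by (simp add: f_bracket vec_eq_iff forall_4 R2_bracket_components)
  then have "bracket a (bracket b c) = 0" for a b c
    using bij by (metis bij_is_inj injD)
  then show ?thesis
    by (simp add: dextral_symmetric_def)
qed

text \<open>The linear map is built out of \<open>complex ^ 4\<close>, where it is given by a
  formula in the coordinates; \<open>algebra_isomorphic_UNIV_symI\<close> then reverses it.\<close>

lemma R2_isomorphicI:
  fixes scale :: "complex \<Rightarrow> 'a::ab_group_add \<Rightarrow> 'a"
  assumes "right_leibniz_algebra scale bracket"
    and span: "\<And>v. \<exists>a b c d. v = scale a x + scale b y + scale c z + scale d w"
    and indep: "\<And>a b c d. scale a x + scale b y + scale c z + scale d w = 0 \<Longrightarrow>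
      a = 0 \<and> b = 0 \<and> c = 0 \<and> d = 0"
    and "bracket x x = 0" "bracket x y = 0" "bracket x z = 0" "bracket x w = 0"
    and "bracket y x = 0" "bracket y y = 0" "bracket y z = 0" "bracket y w = 0"
    and "bracket z x = z" "bracket z y = w" "bracket z z = 0" "bracket z w = 0"
    and "bracket w x = w" "bracket w y = 0" "bracket w z = 0" "bracket w w = 0"
  shows "algebra_isomorphic scale bracket UNIV (*s) R2_bracket UNIV"
proof -
  interpret right_leibniz_algebra scale bracket by fact
  define g where "g v = scale (v $ 1) x + scale (v $ 2) y + scale (v $ 3) z + scale (v $ 4) w"
    for v :: "complex ^ 4"
  have add: "g (u + v) = g u + g v" and scale: "g (r *s u) = scale r (g u)" for u v r
    by (simp_all add: g_def scale_left_distrib scale_right_distrib algebra_simps)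
  have "inj g"
  proof (rule injI)
    fix u v assume "g u = g v"
    then have "g (u - v) = 0"
      by (simp add: g_def scale_left_diff_distrib algebra_simps)
    then show "u = v"
      using indep unfolding g_def by (force simp: vec_eq_iff forall_4)
  qed
  moreover have "surj g"
    unfolding surj_def
  proof
    fix v
    obtain a b c d where "v = scale a x + scale b y + scale c z + scale d w"
      using span by blast
    then have "v = g (\<chi> i. if i = 1 then a else if i = 2 then b else if i = 3 then c else d)"
      by (simp add: g_def)
    then show "\<exists>u. v = g u" ..
  qed
  moreover have "g (R2_bracket u v) = bracket (g u) (g v)" for u v
    using assms(4-)
    by (simp add: g_def R2_bracket_components bracket_linear scale_left_distrib algebra_simps)
  ultimately show ?thesis
    using add scale by (intro algebra_isomorphic_UNIV_symI) (auto simp: bij_def)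
qed

text \<open>This is the case \<alpha> = 0, in a basis of \<open>N\<close> whose only product is
  [x, y] = z. Dextral symmetry removes the \<open>y\<close> component from all brackets of
  \<open>t\<close> with \<open>N\<close>; the Leibniz identity fixes the remaining coefficients up
  to terms that a change of basis absorbs.\<close>

lemma dextral_symmetric_R2_isomorphic:
  fixes scale :: "complex \<Rightarrow> 'a::ab_group_add \<Rightarrow> 'a"
  assumes "right_leibniz_algebra scale bracket"
    and N: "\<And>n. n \<in> N \<longleftrightarrow> (\<exists>a b c. n = scale a x + scale b y + scale c z)"
    and indep: "\<And>a b c. scale a x + scale b y + scale c z = 0 \<Longrightarrow> a = 0 \<and> b = 0 \<and> c = 0"
    and table: "bracket x x = 0" "bracket x y = z" "bracket x z = 0"
      "bracket y x = 0" "bracket y y = 0" "bracket y z = 0"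
      "bracket z x = 0" "bracket z y = 0" "bracket z z = 0"
    and sub: "\<And>a b. bracket a b \<in> N" and t: "t \<notin> N"
    and complement: "\<And>t v. t \<notin> N \<Longrightarrow> \<exists>r. \<exists>n\<in>N. v = scale r t + n"
    and not_nil: "\<not> right_leibniz_algebra.nilpotent scale bracket UNIV"
    and dextral: "right_leibniz_algebra.dextral_symmetric bracket"
  shows "algebra_isomorphic scale bracket UNIV (*s) R2_bracket UNIV"
proof -
  interpret right_leibniz_algebra scale bracket by fact
  have subN: "subspace N"
  proof -
    have "N = span {x, y, z}"
      using N by (auto simp: mem_span_triple)
    then show ?thesis by simp
  qed
  have N_xyz: "x \<in> N" "y \<in> N" "z \<in> N"
    using N[of x] N[of y] N[of z]
    by (metis add.right_neutral add_0 scale_one scale_zero_left)+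
  have z_0: "scale a z = 0 \<Longrightarrow> a = 0" for a
    using indep[of 0 0 a] by simp
  have t_z: "bracket t z = 0" for t
  proof -
    \<comment> \<open>In this basis \<open>z\<close> is reached as a symmetrised product, which left
      multiplication by any \<open>t\<close> kills.\<close>
    have "z = bracket x y + bracket y x"
      using table by simp
    then show ?thesis
      using bracket_symmetric_right[of t x y] by (simp add: bracket_linear)
  qed
  have N_N: "bracket u v \<in> span {z}" if "u \<in> N" "v \<in> N" for u v
    using that table
    by (auto simp: N bracket_linear span_singleton simp flip: scale_left_distrib)
  \<comment> \<open>Left multiplication by \<open>x\<close> reads off the \<open>y\<close>
    coefficient. Together with \<open>t_N\<close> this applies to every bracket of \<open>t\<close>
    with an element of \<open>N\<close>.\<close>
  have *: "\<exists>a b. v = scale a x + scale b z" if v_N: "v \<in> N" and "bracket x v = 0" for v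
  proof -
    obtain a b c where v: "v = scale a x + scale b y + scale c z"
      using v_N N by blast
    then have "scale b z = 0"
      using \<open>bracket x v = 0\<close> by (simp add: bracket_linear table)
    then show "\<exists>a b. v = scale a x + scale b z"
      using z_0[of b] v by auto
  qed
  have t_N: "bracket u (bracket t v) = 0" "bracket u (bracket v t) = 0" if "u \<in> N" "v \<in> N" for t u v
  proof -
    have "bracket t (bracket u v) = 0" if "u \<in> N" "v \<in> N" for u v
      using N_N[OF that] by (auto simp: span_singleton bracket_linear t_z)
    then show "bracket u (bracket t v) = 0" "bracket u (bracket v t) = 0"
      using dextral_symmetric_bracket_ideal[OF dextral, of N t] that by blast+
  qed
  obtain a \<mu> where xt: "bracket x t = scale a x + scale \<mu> z"
    using * t_N sub N_xyz by metis
  obtain b \<kappa> where yt: "bracket y t = scale b x + scale \<kappa> z"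
    using * t_N sub N_xyz by metis
  \<comment> \<open>Right multiplication by \<open>t\<close> is a derivation, and applied to [y, y]
    = 0 it yields b z.\<close>
  have "scale b z = 0"
    using bracket_derivation[of y y t] by (simp add: yt table bracket_linear)
  then have b: "b = 0"
    using z_0 by blast
  have zt: "bracket z t = scale a z"
    using bracket_derivation[of x y t] by (simp add: xt yt table bracket_linear)
  \<comment> \<open>Otherwise right multiplication by \<open>t\<close> maps \<open>N\<close> into
    the line of \<open>z\<close> and kills \<open>z\<close>, so the whole algebra would be
    nilpotent.\<close>
  have "a \<noteq> 0"
  proof
    assume "a = 0"
    have "bracket n v \<in> span {z}" if n: "n \<in> N" for n v
    proof -
      obtain r m where m: "v = scale r t + m" "m \<in> N"
        using complement[OF t] by blast
      have "bracket n t \<in> span {z}"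
        using n xt yt zt \<open>a = 0\<close> b
        by (auto simp: N bracket_linear span_singleton simp flip: scale_left_distrib)
      then show ?thesis
        using m N_N[OF n m(2)] by (simp add: bracket_linear span_add span_scale)
    qed
    moreover have "bracket z v = 0" for v
    proof -
      obtain r m where "v = scale r t + m" "m \<in> N"
        using complement[OF t] by blast
      then show ?thesis
        using zt \<open>a = 0\<close> table by (auto simp: N bracket_linear)
    qed
    ultimately have "nilpotent UNIV"
      using subN sub by (intro nilpotent_UNIV_I)
    with not_nil show False by blast
  qed
  \<comment> \<open>Subtracting \<mu> y removes \<mu> z from [x, t] because [x, y] = z, and division
    by \<open>a\<close> makes the eigenvalue on \<open>x\<close> and \<open>z\<close> equal to 1. As
    [z, t1] = z and [y, t1] = (\<kappa> / a) z, the shift of \<open>y\<close> by \<open>k\<close>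
    makes [y1, t1] vanish.\<close>
  define t1 where "t1 = scale (1 / a) (t - scale \<mu> y)"
  define k where "k = \<kappa> / a"
  define y1 where "y1 = y - scale k z"
  have t1: "bracket x t1 = x" "bracket z t1 = z" "bracket y1 t1 = 0"
    using \<open>a \<noteq> 0\<close> b
    by (simp_all add: t1_def y1_def k_def bracket_linear xt yt zt table)
  have y1_N: "y1 \<in> N"
    using N_xyz subN by (simp add: y1_def subspace_diff subspace_scale)
  have y1: "bracket x y1 = z" "bracket y1 x = 0" "bracket y1 y1 = 0" "bracket y1 z = 0" "bracket z y1 = 0"
    by (simp_all add: y1_def bracket_linear table)
  have "bracket x (bracket t1 t1) = 0"
    by (rule bracket_square_right)
  then obtain \<rho> \<tau> where tt: "bracket t1 t1 = scale \<rho> x + scale \<tau> z"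
    using * sub by blast
  obtain \<beta> \<delta> where tx: "bracket t1 x = scale \<beta> x + scale \<delta> z"
    using * t_N sub N_xyz by metis
  obtain \<gamma> \<eta> where ty: "bracket t1 y1 = scale \<gamma> x + scale \<eta> z"
    using * t_N sub N_xyz y1_N by metis
  \<comment> \<open>The left side is [t1, z] = 0, and on the right only \<beta> [x, y1] survives.
    The next two applications of the Leibniz identity determine \<delta>, \<gamma> and \<eta> in the
    same way.\<close>
  have "scale \<beta> z = 0"
    using right_leibniz[of t1 x y1] by (simp add: y1 tx ty t_z table bracket_linear)
  then have \<beta>: "\<beta> = 0"
    using z_0 by blast
  have "scale \<delta> z = 0"
    using right_leibniz[of t1 t1 x] \<beta> by (simp add: tx tt t1 t_z table bracket_linear)
  then have tx_0: "bracket t1 x = 0"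
    using z_0 \<beta> tx by simp
  have "scale \<gamma> x + scale 0 y + scale (\<eta> - \<rho>) z = 0"
    using right_leibniz[of t1 t1 y1]
    by (simp add: tx_0 ty tt t1 y1 t_z bracket_linear scale_left_diff_distrib algebra_simps)
  then have "\<gamma> = 0" "\<eta> = \<rho>"
    using indep by fastforce+
  then have ty: "bracket t1 y1 = scale \<rho> z"
    using ty by simp
  \<comment> \<open>Because \<open>t1\<close> acts on \<open>x\<close> and \<open>z\<close> from the
    right as the identity and from the left as zero, this shift cancels [t1, t1]. Thanks to \<eta> =
    \<rho> it cancels [t1, y1] as well.\<close>
  define t2 where "t2 = t1 - scale \<rho> x - scale \<tau> z"
  have t2: "bracket t2 t2 = 0" "bracket t2 y1 = 0" "bracket t2 x = 0" "bracket t2 z = 0"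
    "bracket x t2 = x" "bracket z t2 = z" "bracket y1 t2 = 0"
    by (simp_all add: t2_def bracket_linear tx_0 ty tt t1 y1 t_z table)
  have t2_N: "t2 \<notin> N"
  proof
    assume "t2 \<in> N"
    \<comment> \<open>Here x = [x, t2] would be a product of two elements of
      \<open>N\<close>.\<close>
    then have "x \<in> span {z}"
      using N_N[of x t2] N_xyz t2 by simp
    then obtain c where "x = scale c z"
      by (auto simp: span_singleton)
    then show False
      using indep[of 1 0 "- c"] by simp
  qed
  show ?thesis
  \<comment> \<open>The vectors \<open>t2\<close>, \<open>y1\<close>, \<open>x\<close>,
    \<open>z\<close> play the roles of x, y, z, w in the table of R_2.\<close>
  proof (rule R2_isomorphicI[of scale bracket t2 y1 x z])
    fix v
    obtain r a b c where "v = scale r t2 + (scale a x + scale b y + scale c z)"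
      using complement[OF t2_N] N by metis
    then have "v = scale r t2 + scale b y1 + scale a x + scale (c + b * k) z"
      by (simp add: y1_def scale_left_distrib scale_right_diff_distrib)
    then show "\<exists>a b c d. v = scale a t2 + scale b y1 + scale c x + scale d z"
      by blast
  next
    fix a b c d assume "scale a t2 + scale b y1 + scale c x + scale d z = 0"
    then have eq: "scale a t2 + (scale c x + scale b y + scale (d - b * k) z) = 0"
      by (simp add: y1_def scale_left_diff_distrib scale_right_diff_distrib algebra_simps)
    have "scale c x + scale b y + scale (d - b * k) z \<in> N"
      using N by blast
    then have "scale a t2 \<in> N"
      using eq subN by (metis add_eq_0_iff2 subspace_neg)
    then have "a = 0"
      using t2_N subspace_scale_cancel[OF subN] by blast
    then show "a = 0 \<and> b = 0 \<and> c = 0 \<and> d = 0"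
      using eq indep[of c b "d - b * k"] by simp
  qed (use t2 y1 table assms(1) in auto)
qed

theorem proposition5p8:
  fixes \<alpha> :: complex
    and scale :: "complex \<Rightarrow> 'a::ab_group_add \<Rightarrow> 'a"
    and bracket :: "'a \<Rightarrow> 'a \<Rightarrow> 'a"
    and N :: "'a set"
  assumes "right_leibniz_algebra scale bracket"
    and "vector_space.dim scale (UNIV :: 'a set) = 4"
    and "right_leibniz_algebra.solvable scale bracket UNIV"
    and "right_leibniz_algebra.nilradical scale bracket N"
    and "algebra_isomorphic scale bracket N (*s) (mu3_bracket \<alpha>) UNIV"
  shows "right_leibniz_algebra.dextral_symmetric bracket \<longleftrightarrow>
         algebra_isomorphic scale bracket UNIV (*s) R2_bracket UNIV"
proof -
  interpret right_leibniz_algebra scale bracket by fact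
  have ideal: "two_sided_ideal N"
    using assms(4) by (simp add: nilradical_def)
  obtain x y z where
    N: "\<And>n. n \<in> N \<longleftrightarrow> (\<exists>a b c. n = scale a x + scale b y + scale c z)"
    and indep: "\<And>a b c. scale a x + scale b y + scale c z = 0 \<Longrightarrow> a = 0 \<and> b = 0 \<and> c = 0"
    and table: "bracket x x = z" "bracket x y = z" "bracket x z = 0"
      "bracket y x = 0" "bracket y y = scale \<alpha> z" "bracket y z = 0"
      "bracket z x = 0" "bracket z y = 0" "bracket z z = 0"
    using mu3_isomorphic_basis[OF assms(1) ideal assms(5)] by metis
  have "N \<noteq> UNIV" and complement: "\<And>t v. t \<notin> N \<Longrightarrow> \<exists>r. \<exists>n\<in>N. v = scale r t + n"
    using hyperplane_complement[OF assms(2) N indep] by metis+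
  then have not_nil: "\<not> nilpotent UNIV"
    using not_nilpotent_UNIV_I assms(4) by blast
  obtain t where t: "t \<notin> N"
    using \<open>N \<noteq> UNIV\<close> by blast
  have sub: "bracket a b \<in> N" for a b
    using bracket_in_hyperplane_ideal[OF ideal t] complement[OF t] by blast
  have "algebra_isomorphic scale bracket UNIV (*s) R2_bracket UNIV" if dextral: "dextral_symmetric"
  proof (cases "\<alpha> = 0")
    case False
    have "nilpotent UNIV"
      using mu3_nondegenerate_nilpotent[OF N indep table False sub complement[OF t] dextral] .
    with not_nil show ?thesis by blast
  next
    case True
    \<comment> \<open>For \<alpha> = 0 the vector \<open>x - y\<close> squares to zero, since [x, x]
      and [x, y] both equal \<open>z\<close>, while its product with \<open>y\<close> is still
      \<open>z\<close>.\<close>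
    show ?thesis
    proof (rule dextral_symmetric_R2_isomorphic[OF assms(1), of N "x - y" y z t])
      show "n \<in> N \<longleftrightarrow> (\<exists>a b c. n = scale a (x - y) + scale b y + scale c z)" for n
      proof
        assume "n \<in> N"
        then obtain a b c where "n = scale a x + scale b y + scale c z"
          using N by blast
        then have "n = scale a (x - y) + scale (a + b) y + scale c z"
          by (simp add: scale_left_distrib scale_right_diff_distrib)
        then show "\<exists>a b c. n = scale a (x - y) + scale b y + scale c z"
          by blast
      next
        assume "\<exists>a b c. n = scale a (x - y) + scale b y + scale c z"
        then obtain a b c where "n = scale a (x - y) + scale b y + scale c z"
          by blast
        then have "n = scale a x + scale (b - a) y + scale c z"
          by (simp add: scale_left_diff_distrib scale_right_diff_distrib)
        then show "n \<in> N"
          using N by blast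
      qed
    next
      fix a b c assume "scale a (x - y) + scale b y + scale c z = 0"
      then have "scale a x + scale (b - a) y + scale c z = 0"
        by (simp add: scale_left_diff_distrib scale_right_diff_distrib algebra_simps)
      then show "a = 0 \<and> b = 0 \<and> c = 0"
        using indep by fastforce
    qed (use table True sub t complement not_nil dextral in \<open>simp_all add: bracket_linear\<close>)
  qed
  then show ?thesis
    using algebra_isomorphic_R2_dextral_symmetric[OF assms(1)] by blast
qed

end
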